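(* Let $G=\mathrm{PSL}(2,q)$ with $q=2^f$, $f\ge 1$ an integer. Then the Engel graph $\Gamma(G)$ is not strongly connected.
   Context: Commutators: $[a,b]=a^{-1}b^{-1}ab$, $[x,{}_0y]=x$, and $[x,{}_{i+1}y]=[[x,{}_iy],y]$ for $i\ge 0$. For a finite group $G$ with hypercenter $Z_\infty(G)$, the Engel graph $\Gamma(G)$ is the directed graph with vertex set $G\setminus Z_\infty(G)$ and an edge $x\mapsto y$ if and only if $[x,{}_ny]=1$ for some integer $n>0$. A directed graph is strongly connected if for every pair of vertices $(x,y)$ it contains a directed path from $x$ to $y$. *)

theory Defs
  imports
    "HOL-Analysis.Determinants"
    "HOL-Algebra.Coset"
    "Graph_Theory.Pair_Digraph"
begin

definition group_center :: "('a, 'b) monoid_scheme \<Rightarrow> 'a set" where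
  "group_center G = {z \<in> carrier G. \<forall>x\<in>carrier G. z \<otimes>\<^bsub>G\<^esub> x = x \<otimes>\<^bsub>G\<^esub> z}"

text \<open>The upper central series: \<open>Z\<^sub>0 = 1\<close> and \<open>Z\<^sub>n\<^sub>+\<^sub>1\<close> is the full preimage in \<open>G\<close>
  of the centre of \<open>G / Z\<^sub>n\<close>.\<close>

primrec upper_central :: "('a, 'b) monoid_scheme \<Rightarrow> nat \<Rightarrow> 'a set" where
  "upper_central G 0 = {\<one>\<^bsub>G\<^esub>}"
| "upper_central G (Suc n) =
     {x \<in> carrier G. upper_central G n #>\<^bsub>G\<^esub> x \<in> group_center (G Mod upper_central G n)}"

text \<open>Only the finite part of the (in general transfinite) upper central series is used;
  for a finite group its union is the terminal member of the series.\<close>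

definition hypercenter :: "('a, 'b) monoid_scheme \<Rightarrow> 'a set" where
  "hypercenter G = (\<Union>n. upper_central G n)"

definition group_commutator :: "('a, 'b) monoid_scheme \<Rightarrow> 'a \<Rightarrow> 'a \<Rightarrow> 'a" where
  "group_commutator G a b =
     inv\<^bsub>G\<^esub> a \<otimes>\<^bsub>G\<^esub> inv\<^bsub>G\<^esub> b \<otimes>\<^bsub>G\<^esub> a \<otimes>\<^bsub>G\<^esub> b"

primrec engel_commutator :: "('a, 'b) monoid_scheme \<Rightarrow> 'a \<Rightarrow> nat \<Rightarrow> 'a \<Rightarrow> 'a" where
  "engel_commutator G x 0 y = x"
| "engel_commutator G x (Suc i) y = group_commutator G (engel_commutator G x i y) y"

definition engel_graph :: "('a, 'b) monoid_scheme \<Rightarrow> 'a pair_pre_digraph" where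
  "engel_graph G =
     \<lparr> pverts = carrier G - hypercenter G,
       parcs = {(x, y). x \<in> carrier G - hypercenter G \<and> y \<in> carrier G - hypercenter G \<and>
                        (\<exists>n>0. engel_commutator G x n y = \<one>\<^bsub>G\<^esub>)} \<rparr>"

text \<open>Unlike the constant \<open>strongly_connected\<close> of the Graph Theory entry, this does not demand
  a nonempty vertex set, so its negation really provides an unreachable pair of vertices.\<close>

definition strongly_connected_digraph :: "('a, 'b) pre_digraph \<Rightarrow> bool" where
  "strongly_connected_digraph D \<longleftrightarrow> (\<forall>x\<in>verts D. \<forall>y\<in>verts D. x \<rightarrow>\<^sup>*\<^bsub>D\<^esub> y)"

definition SL :: "('k::field ^ 'n ^ 'n) monoid" where
  "SL = \<lparr> carrier = {A. det A = 1}, mult = (**), one = mat 1 \<rparr>"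

definition PSL :: "('k::field ^ 'n ^ 'n) set monoid" where
  "PSL = SL Mod group_center SL"

end

(*
Elements of SL(2,q) that have no eigenvalue in the field form, together with 1, non-split tori.
Let T be such a torus, generated by the companion matrix of X^2 + tX + 1 with t not of the form
z + 1/z. No arc leaves T - {1}: suppose x in T - {1} and [x,_n y] = 1 with y nontrivial.
If tr y = 0, then y is an involution and [x,_(i+1) y] = [x,_i y]^(-2) for i > 0; as
tr (A^2) = (tr A)^2, this gives tr [x, y] = 0, and tr [x, y] = (tr (x(y+1)))^2 would produce an
eigenvalue of x. If tr y is nonzero, then [w, y] commutes with y only if w centralises or inverts
y, and the traces of w and w y^(-1) exclude inversion for w = [x,_i y], so x commutes with y.
Since q is even, PSL(2,q) is SL(2,q), with trivial hypercentre.
*)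
theory Submission
  imports Defs
begin

section \<open>Groups with trivial centre\<close>

lemma (in group) rcos_one_singleton: "x \<in> carrier G \<Longrightarrow> {\<one>} #> x = {x}"
  by (auto simp: r_coset_def)

text \<open>Even over a trivial centre, \<open>PSL\<close> is formally a quotient whose elements are
  singleton cosets. The facts here move products, inverses, centres and commutators along
  \<open>x\<close> to \<open>{x}\<close>, so that the real work takes place in
  \<open>SL\<close>.\<close>

lemma (in group) carrier_FactGroup_one: "carrier (G Mod {\<one>}) = (\<lambda>x. {x}) ` carrier G"
  by (auto simp: FactGroup_def RCOSETS_def rcos_one_singleton)

lemma set_mult_singletons: "{x} <#>\<^bsub>G\<^esub> {y} = {x \<otimes>\<^bsub>G\<^esub> y}"
  by (simp add: set_mult_def)

lemma one_FactGroup [simp]: "\<one>\<^bsub>G Mod N\<^esub> = N"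
  by (simp add: FactGroup_def)

lemma (in group) inv_FactGroup_one:
  assumes "x \<in> carrier G" shows "inv\<^bsub>G Mod {\<one>}\<^esub> {x} = {inv x}"
proof -
  interpret F: group "G Mod {\<one>}"
    by (rule normal.factorgroup_is_group[OF one_is_normal])
  show ?thesis
    by (rule F.inv_equality) (use assms in \<open>auto simp: set_mult_singletons carrier_FactGroup_one\<close>)
qed

lemma (in group) group_center_FactGroup_one:
  "group_center (G Mod {\<one>}) = (\<lambda>x. {x}) ` group_center G"
  by (auto simp: group_center_def carrier_FactGroup_one set_mult_singletons)

text \<open>Once one term of the series is trivial, the next is the preimage of the centre of the
  quotient by 1, which is again trivial.\<close>

lemma (in group) hypercenter_trivial:
  assumes "group_center G = {\<one>}" shows "hypercenter G = {\<one>}"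
proof -
  have "upper_central G n = {\<one>}" for n
  proof (induction n)
    case (Suc n)
    have "upper_central G (Suc n) = {x \<in> carrier G. {x} \<in> {{\<one>}}}"
      by (intro Collect_cong conj_cong refl upper_central.simps(2)[THEN trans])
         (simp only: Suc rcos_one_singleton group_center_FactGroup_one assms image_insert image_empty)
    then show ?case by auto
  qed simp
  then show ?thesis by (simp add: hypercenter_def)
qed

lemma (in group) hypercenter_FactGroup_one:
  assumes "group_center G = {\<one>}" shows "hypercenter (G Mod {\<one>}) = {{\<one>}}"
proof -
  interpret F: group "G Mod {\<one>}"
    by (rule normal.factorgroup_is_group[OF one_is_normal])
  show ?thesis
    using F.hypercenter_trivial by (simp add: group_center_FactGroup_one assms)
qed

section \<open>Engel commutators and the Engel graph of the quotient by 1\<close>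

lemma (in group) group_commutator_closed:
  "\<lbrakk>x \<in> carrier G; y \<in> carrier G\<rbrakk> \<Longrightarrow> group_commutator G x y \<in> carrier G"
  by (simp add: group_commutator_def)

lemma (in group) engel_commutator_closed:
  "\<lbrakk>x \<in> carrier G; y \<in> carrier G\<rbrakk> \<Longrightarrow> engel_commutator G x n y \<in> carrier G"
  by (induction n) (auto simp: group_commutator_closed)

lemma (in group) engel_commutator_FactGroup_one:
  assumes "x \<in> carrier G" "y \<in> carrier G"
  shows "engel_commutator (G Mod {\<one>}) {x} n {y} = {engel_commutator G x n y}"
  using assms
  by (induction n)
     (auto simp: group_commutator_def inv_FactGroup_one set_mult_singletons engel_commutator_closed)

lemma (in group) engel_graph_FactGroup_one_arc_iff:
  assumes "group_center G = {\<one>}"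
  shows "(X, Y) \<in> parcs (engel_graph (G Mod {\<one>})) \<longleftrightarrow>
    (\<exists>x\<in>carrier G - {\<one>}. \<exists>y\<in>carrier G - {\<one>}. X = {x} \<and> Y = {y} \<and>
      (\<exists>n>0. engel_commutator G x n y = \<one>))"
proof -
  have "hypercenter (G Mod {\<one>}) = {{\<one>}}"
    by (rule hypercenter_FactGroup_one[OF assms])
  then show ?thesis
    by (auto simp: engel_graph_def carrier_FactGroup_one engel_commutator_FactGroup_one)
      (metis less_irrefl)
qed

lemma (in group) pverts_engel_graph_FactGroup_one:
  assumes "group_center G = {\<one>}"
  shows "pverts (engel_graph (G Mod {\<one>})) = (\<lambda>x. {x}) ` (carrier G - {\<one>})"
proof -
  have "hypercenter (G Mod {\<one>}) = {{\<one>}}"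
    by (rule hypercenter_FactGroup_one[OF assms])
  then show ?thesis
    by (auto simp: engel_graph_def carrier_FactGroup_one)
qed

text \<open>This refutes strong connectivity: it is enough to find a set that no arc leaves, with
  one vertex inside and one outside.\<close>

lemma reachable_closed_set:
  assumes "x \<rightarrow>\<^sup>*\<^bsub>with_proj D\<^esub> y" "x \<in> S"
    and "\<And>u v. (u, v) \<in> parcs D \<Longrightarrow> u \<in> S \<Longrightarrow> v \<in> S"
  shows "y \<in> S"
  using assms(1,2) unfolding reachable_def
proof (induction rule: rtrancl_on_induct)
  case base then show ?case by simp
next
  case (step u v)
  then show ?case using assms(3) by (auto simp: arcs_ends_def arc_to_ends_def)
qed

section \<open>Commutators with a fixed element\<close>

text \<open>The right side is a conjugate of \<open>inv y\<close>. In \<open>SL\<close> this fixes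
  the trace of the left side, whatever \<open>v\<close> is.\<close>

lemma (in group) commutator_mult_inv:
  assumes "v \<in> carrier G" "y \<in> carrier G"
  shows "group_commutator G v y \<otimes> inv y = inv v \<otimes> inv y \<otimes> v"
  using assms by (simp add: group_commutator_def m_assoc)

lemma (in group) commutes_inv:
  assumes "x \<in> carrier G" "y \<in> carrier G" "x \<otimes> y = y \<otimes> x"
  shows "inv x \<otimes> y = y \<otimes> inv x"
proof -
  have "inv x \<otimes> y = inv x \<otimes> (y \<otimes> x) \<otimes> inv x" using assms(1,2) by (simp add: m_assoc)
  also have "\<dots> = inv x \<otimes> (x \<otimes> y) \<otimes> inv x" by (simp only: assms(3))
  also have "\<dots> = y \<otimes> inv x" using assms(1,2) by (simp add: m_assoc[symmetric])
  finally show ?thesis .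
qed

lemma (in group) commutator_commutes_imp_conj_commutes:
  assumes "w \<in> carrier G" "y \<in> carrier G"
    and "group_commutator G w y \<otimes> y = y \<otimes> group_commutator G w y"
  shows "(inv w \<otimes> y \<otimes> w) \<otimes> y = y \<otimes> (inv w \<otimes> y \<otimes> w)"
proof -
  let ?c = "group_commutator G w y"
  have c: "?c \<in> carrier G" using assms by (simp add: group_commutator_closed)
  have "(?c \<otimes> inv y) \<otimes> y = (?c \<otimes> y) \<otimes> inv y" using c assms(2) by (simp add: m_assoc)
  also have "\<dots> = y \<otimes> (?c \<otimes> inv y)" using c assms(2) by (simp only: assms(3) m_assoc inv_closed)
  finally have "(?c \<otimes> inv y) \<otimes> y = y \<otimes> (?c \<otimes> inv y)" .
  then have "inv (inv w \<otimes> inv y \<otimes> w) \<otimes> y = y \<otimes> inv (inv w \<otimes> inv y \<otimes> w)"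
    using assms by (intro commutes_inv) (simp_all add: commutator_mult_inv)
  then show ?thesis using assms by (simp add: inv_mult_group m_assoc)
qed

text \<open>With \<open>inv y = y\<close>, conjugation by \<open>y\<close> inverts c = [v,y], so
  [c,y] is the product of two copies of the inverse of c.\<close>

lemma (in group) commutator_commutator_involution:
  assumes "v \<in> carrier G" "y \<in> carrier G" "y \<otimes> y = \<one>"
  shows "group_commutator G (group_commutator G v y) y
    = inv (group_commutator G v y) \<otimes> inv (group_commutator G v y)"
proof -
  have y: "inv y = y" using assms by (simp add: inv_equality)
  show ?thesis using assms by (simp add: group_commutator_def inv_mult_group y m_assoc)
qed

section \<open>The group SL(2) in characteristic two\<close>

lemma matrix_2_eq_iff:
  fixes A B :: "'a ^ 2 ^ 2"
  shows "A = B \<longleftrightarrow> A$1$1 = B$1$1 \<and> A$1$2 = B$1$2 \<and> A$2$1 = B$2$1 \<and> A$2$2 = B$2$2"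
  by (auto simp: vec_eq_iff forall_2)

lemma matrix_mult_2:
  fixes A B :: "'a::semiring_1 ^ 2 ^ 2"
  shows "(A ** B)$i$j = A$i$1 * B$1$j + A$i$2 * B$2$j"
  by (simp add: matrix_matrix_mult_def sum_2)

lemma trace_2: "trace (A :: 'a::semiring_1 ^ 2 ^ 2) = A$1$1 + A$2$2"
  by (simp add: trace_def sum_2)

lemma mat_2_nth [simp]:
  "(mat c :: 'a::zero^2^2)$1$1 = c" "(mat c :: 'a^2^2)$1$2 = 0"
  "(mat c :: 'a^2^2)$2$1 = 0" "(mat c :: 'a^2^2)$2$2 = c"
  by (simp_all add: mat_def)

lemma SL_simps [simp]:
  "A \<in> carrier SL \<longleftrightarrow> det A = 1" "A \<otimes>\<^bsub>SL\<^esub> B = A ** B" "\<one>\<^bsub>SL\<^esub> = mat 1"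
  by (simp_all add: SL_def)

lemma group_SL: "group (SL :: ('k::field ^ 'n ^ 'n) monoid)"
proof (rule groupI)
  fix A :: "'k^'n^'n" assume A: "A \<in> carrier SL"
  then have "invertible A" by (simp add: invertible_det_nz)
  then obtain B where B: "B ** A = mat 1" by (auto simp: invertible_def)
  then have "det B * det A = 1" by (metis det_I det_mul)
  with A B show "\<exists>B\<in>carrier SL. B \<otimes>\<^bsub>SL\<^esub> A = \<one>\<^bsub>SL\<^esub>" by (intro bexI[of _ B]) auto
qed (auto simp: det_mul matrix_mul_assoc)

interpretation SL: group "SL :: ('k::field ^ 'n ^ 'n) monoid"
  by (rule group_SL)

lemma SL_inv_2:
  fixes A :: "'k::field ^ 2 ^ 2"
  assumes "det A = 1"
  shows "(inv\<^bsub>SL\<^esub> A)$1$1 = A$2$2" "(inv\<^bsub>SL\<^esub> A)$1$2 = - A$1$2"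
    "(inv\<^bsub>SL\<^esub> A)$2$1 = - A$2$1" "(inv\<^bsub>SL\<^esub> A)$2$2 = A$1$1"
proof -
  \<comment> \<open>The adjugate, which is the inverse at determinant 1.\<close>
  let ?B = "vector [vector [A$2$2, - A$1$2], vector [- A$2$1, A$1$1]] :: 'k^2^2"
  have "inv\<^bsub>SL\<^esub> A = ?B"
    by (rule SL.inv_equality)
       (use assms in \<open>auto simp: det_2 matrix_2_eq_iff matrix_mult_2 algebra_simps\<close>)
  then show "(inv\<^bsub>SL\<^esub> A)$1$1 = A$2$2" "(inv\<^bsub>SL\<^esub> A)$1$2 = - A$1$2"
    "(inv\<^bsub>SL\<^esub> A)$2$1 = - A$2$1" "(inv\<^bsub>SL\<^esub> A)$2$2 = A$1$1" by simp_all
qed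

lemma trace_SL_inv_2:
  fixes A :: "'k::field ^ 2 ^ 2"
  shows "det A = 1 \<Longrightarrow> trace (inv\<^bsub>SL\<^esub> A) = trace A"
  by (simp add: trace_2 SL_inv_2)

lemma trace_SL_conj:
  fixes w y :: "'k::field ^ 'n ^ 'n"
  assumes "det w = 1"
  shows "trace (inv\<^bsub>SL\<^esub> w ** y ** w) = trace y"
proof -
  have "trace (inv\<^bsub>SL\<^esub> w ** y ** w) = trace (w ** (inv\<^bsub>SL\<^esub> w ** y))"
    by (rule trace_mul_sym)
  also have "w ** (inv\<^bsub>SL\<^esub> w ** y) = y"
    using SL.r_inv[of w] assms by (simp add: matrix_mul_assoc)
  finally show ?thesis .
qed

lemma char_2_simps:
  fixes a b :: "'k::field"
  assumes "(2::'k) = 0"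
  shows "a + a = 0" "a + (a + b) = b" "- a = a" "a - b = a + b"
proof -
  show 1: "a + a = 0" for a :: 'k using assms by (metis mult_2 mult_zero_left)
  show "a + (a + b) = b" using 1 by (simp flip: add.assoc)
  show 2: "- a = a" for a :: 'k using 1[of a] by (simp add: minus_unique)
  show "a - b = a + b" using 2[of b] by (metis diff_conv_add_uminus)
qed

text \<open>Commuting with the two elementary unipotent matrices makes z a scalar a, and a^2 = 1
  forces a = 1 in characteristic two.\<close>

lemma group_center_SL_2:
  assumes two: "(2::'k::field) = 0"
  shows "group_center (SL :: ('k ^ 2 ^ 2) monoid) = {mat 1}"
proof (intro equalityI subsetI)
  fix z :: "'k^2^2" assume z: "z \<in> group_center SL"
  let ?u = "vector [vector [1, 1], vector [0, 1]] :: 'k^2^2"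
  let ?l = "vector [vector [1, 0], vector [1, 1]] :: 'k^2^2"
  have "z ** ?u = ?u ** z" "z ** ?l = ?l ** z" and d: "det z = 1"
    using z by (auto simp: group_center_def det_2)
  then have "z$1$2 = 0" "z$2$1 = 0" "z$1$1 = z$2$2"
    by (auto simp: matrix_2_eq_iff matrix_mult_2)
  moreover from this d have "(z$1$1 + 1)^2 = 0"
    using two by (simp add: det_2 power2_eq_square algebra_simps char_2_simps)
  ultimately show "z \<in> {mat 1}"
    using two by (auto simp: matrix_2_eq_iff char_2_simps(3) add_eq_0_iff)
qed (auto simp: group_center_def)

section \<open>Centralisers, and the Engel condition for y of nonzero trace\<close>

lemma commutes_nonscalar_2:
  fixes A B :: "'k::field ^ 2 ^ 2"
  assumes "A ** B = B ** A" and "\<And>c. A \<noteq> mat c"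
  obtains a b where "B = mat a + mat b ** A"
proof -
  have e: "A$i$1 * B$1$j + A$i$2 * B$2$j = B$i$1 * A$1$j + B$i$2 * A$2$j" for i j
    by (metis assms(1) matrix_mult_2)
  \<comment> \<open>Modulo scalars a matrix is the triple of its off-diagonal entries and its
    diagonal difference. Commuting means that the triples of A and B have zero cross product; that
    of A is nonzero, so that of B is a multiple of it.\<close>
  have eqs: "A$1$2 * B$2$1 = B$1$2 * A$2$1"
    "A$1$2 * (B$1$1 - B$2$2) = B$1$2 * (A$1$1 - A$2$2)"
    "A$2$1 * (B$1$1 - B$2$2) = B$2$1 * (A$1$1 - A$2$2)"
    using e[of 1 1] e[of 1 2] e[of 2 1] by algebra+
  have "\<exists>b. B$1$2 = b * A$1$2 \<and> B$2$1 = b * A$2$1 \<and> B$1$1 - B$2$2 = b * (A$1$1 - A$2$2)"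
  proof -
    consider "A$1$2 \<noteq> 0" | "A$2$1 \<noteq> 0" | "A$1$1 - A$2$2 \<noteq> 0"
      using assms(2)[of "A$1$1"] by (auto simp: matrix_2_eq_iff)
    then show ?thesis
    proof cases
      case 1
      then show ?thesis using eqs by (intro exI[of _ "B$1$2 / A$1$2"]) (simp add: field_simps)
    next
      case 2
      then show ?thesis using eqs by (intro exI[of _ "B$2$1 / A$2$1"]) (simp add: field_simps)
    next
      case 3
      then show ?thesis using eqs
        by (intro exI[of _ "(B$1$1 - B$2$2) / (A$1$1 - A$2$2)"]) (simp add: nonzero_eq_divide_eq mult.commute)
    qed
  qed
  then obtain b where b: "B$1$2 = b * A$1$2" "B$2$1 = b * A$2$1" "B$1$1 - B$2$2 = b * (A$1$1 - A$2$2)"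
    by blast
  have "B = mat (B$1$1 - b * A$1$1) + mat b ** A"
    using b by (auto simp: matrix_2_eq_iff matrix_mult_2 algebra_simps)
  then show ?thesis by (rule that)
qed

lemma commutes_trans_2:
  fixes A B C :: "'k::field ^ 2 ^ 2"
  assumes "A ** B = B ** A" "A ** C = C ** A" and "\<And>c. A \<noteq> mat c"
  shows "B ** C = C ** B"
proof -
  obtain a b where "B = mat a + mat b ** A" using commutes_nonscalar_2 assms by metis
  moreover obtain c d where "C = mat c + mat d ** A" using commutes_nonscalar_2 assms by metis
  ultimately show ?thesis by (simp add: matrix_2_eq_iff matrix_mult_2 algebra_simps)
qed

lemma nonscalar_if_trace:
  fixes A :: "'k::field ^ 2 ^ 2"
  assumes "(2::'k) = 0" "trace A \<noteq> 0"
  shows "A \<noteq> mat c"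
  using assms by (auto simp: trace_2 char_2_simps)

text \<open>Write u = a + b y. Scalars have trace 0, so b = 1; then the determinant gives a (a + tr
  y) = 0. By Cayley-Hamilton y + tr y is the inverse of y.\<close>

lemma commutes_same_trace_cases:
  fixes y u :: "'k::field ^ 2 ^ 2"
  assumes two: "(2::'k) = 0" and "det y = 1" "det u = 1" "trace u = trace y" "trace y \<noteq> 0"
    and "y ** u = u ** y"
  shows "u = y \<or> u = inv\<^bsub>SL\<^esub> y"
proof -
  note ch = char_2_simps[OF two]
  obtain a b where ab: "u = mat a + mat b ** y"
    using commutes_nonscalar_2 nonscalar_if_trace assms by metis
  have "trace u = b * trace y"
    by (simp add: ab trace_2 matrix_mult_2 algebra_simps ch)
  with assms have b: "b = 1" by simp
  have "det u = det y + a * (a + trace y)"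
    by (simp add: ab b det_2 trace_2 matrix_mult_2 algebra_simps)
  with assms have "a = 0 \<or> a + trace y = 0" by auto
  then consider "a = 0" | "a = trace y" by (auto simp: add_eq_0_iff ch)
  then show ?thesis
    by cases (use assms(2) in
      \<open>simp_all add: ab b matrix_2_eq_iff matrix_mult_2 SL_inv_2 trace_2 ch algebra_simps\<close>)
qed

text \<open>Since y + y^(-1) = tr y, the traces of y w and w y^(-1) add up to tr w tr y; if the two
  products agree, the sum is 0.\<close>

lemma inverts_imp_trace_0:
  fixes w y :: "'k::field ^ 2 ^ 2"
  assumes two: "(2::'k) = 0" and "det y = 1" "trace y \<noteq> 0"
    and "y ** w = w ** inv\<^bsub>SL\<^esub> y"
  shows "trace w = 0"
proof -
  note ch = char_2_simps[OF two]
  have "trace (y ** w) = trace (w ** inv\<^bsub>SL\<^esub> y)" using assms by simp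
  then have "trace (y ** w) + trace (w ** inv\<^bsub>SL\<^esub> y) = 0" by (simp add: ch)
  also have "trace (y ** w) + trace (w ** inv\<^bsub>SL\<^esub> y) = trace w * trace y"
    using assms(2) by (simp add: trace_2 matrix_mult_2 SL_inv_2 ch algebra_simps)
  finally show ?thesis using assms by simp
qed

lemma commutator_commutes_cases:
  fixes w y :: "'k::field ^ 2 ^ 2"
  assumes two: "(2::'k) = 0" and w: "det w = 1" and y: "det y = 1" and tr: "trace y \<noteq> 0"
    and com: "group_commutator SL w y ** y = y ** group_commutator SL w y"
  shows "w ** y = y ** w \<or> trace w = 0 \<and> trace (w ** inv\<^bsub>SL\<^esub> y) = 0"
proof -
  let ?u = "inv\<^bsub>SL\<^esub> w ** y ** w"
  have iw: "det (inv\<^bsub>SL\<^esub> w) = 1" "w ** inv\<^bsub>SL\<^esub> w = mat 1"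
    using SL.inv_closed[of w] SL.r_inv[of w] w by simp_all
  have iy: "inv\<^bsub>SL\<^esub> y ** y = mat 1" "y ** inv\<^bsub>SL\<^esub> y = mat 1"
    using SL.l_inv[of y] SL.r_inv[of y] y by simp_all
  have wu: "w ** ?u = y ** w" using iw by (simp add: matrix_mul_assoc)
  have "?u ** y = y ** ?u"
    using SL.commutator_commutes_imp_conj_commutes[of w y] w y com by simp
  moreover have "det ?u = 1" using w y iw by (simp add: det_mul)
  ultimately consider "?u = y" | "?u = inv\<^bsub>SL\<^esub> y"
    using commutes_same_trace_cases[OF two y, of ?u] tr trace_SL_conj[OF w, of y] by auto
  then show ?thesis
  proof cases
    case 1
    then show ?thesis using wu by simp
  next
    case 2
    then have yw: "y ** w = w ** inv\<^bsub>SL\<^esub> y" using wu by simp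
    \<comment> \<open>The product of w and \<open>inv y\<close> inverts y as well, so its trace
      vanishes too.\<close>
    have "y ** (w ** inv\<^bsub>SL\<^esub> y) = (w ** inv\<^bsub>SL\<^esub> y) ** inv\<^bsub>SL\<^esub> y"
      using yw by (simp add: matrix_mul_assoc)
    with yw show ?thesis using inverts_imp_trace_0[OF two y tr] by blast
  qed
qed

text \<open>Commuting with y, rather than being 1, is the condition that descends from one
  commutator to the previous one, down to x itself.\<close>

lemma engel_imp_commutes:
  fixes x y :: "'k::field ^ 2 ^ 2"
  assumes two: "(2::'k) = 0" and x: "det x = 1" "trace x \<noteq> 0" and y: "det y = 1" "trace y \<noteq> 0"
    and "engel_commutator SL x n y ** y = y ** engel_commutator SL x n y"
  shows "x ** y = y ** x"
  using assms(6)
proof (induction n)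
  case (Suc n)
  let ?w = "engel_commutator SL x n y"
  have w: "det ?w = 1" using SL.engel_commutator_closed[of x y n] x y by simp
  have "?w ** y = y ** ?w \<or> trace ?w = 0 \<and> trace (?w ** inv\<^bsub>SL\<^esub> y) = 0"
    using commutator_commutes_cases[OF two w y] Suc.prems by simp
  \<comment> \<open>Inversion is excluded by tr x at level 0. At later levels it is excluded by the
    other trace, because w y^(-1) is conjugate to y^(-1).\<close>
  moreover have "trace ?w \<noteq> 0 \<or> trace (?w ** inv\<^bsub>SL\<^esub> y) \<noteq> 0"
  proof (cases n)
    case 0
    then show ?thesis using x by simp
  next
    case (Suc m)
    let ?v = "engel_commutator SL x m y"
    have v: "det ?v = 1" using SL.engel_commutator_closed[of x y m] x y by simp
    have "?w ** inv\<^bsub>SL\<^esub> y = inv\<^bsub>SL\<^esub> ?v ** inv\<^bsub>SL\<^esub> y ** ?v"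
      using SL.commutator_mult_inv[of ?v y] v y Suc by simp
    then show ?thesis by (simp only: trace_SL_conj[OF v] trace_SL_inv_2[OF y(1)] y(2) simp_thms)
  qed
  ultimately show ?case using Suc.IH by auto
qed simp

section \<open>The Engel condition for y of trace zero\<close>

lemma trace_square_char_2:
  fixes A :: "'k::field ^ 2 ^ 2"
  assumes "(2::'k) = 0"
  shows "trace (A ** A) = (trace A)^2"
  by (simp add: trace_2 matrix_mult_2 power2_eq_square algebra_simps char_2_simps[OF assms])

lemma square_eq_one_if_trace_0:
  fixes y :: "'k::field ^ 2 ^ 2"
  assumes "(2::'k) = 0" "det y = 1" "trace y = 0"
  shows "y ** y = mat 1"
proof -
  note ch = char_2_simps[OF assms(1)]
  have "y$1$1 = y$2$2" using assms by (simp add: trace_2 add_eq_0_iff ch)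
  then show ?thesis
    using assms(2) by (simp add: det_2 matrix_2_eq_iff matrix_mult_2 ch algebra_simps)
qed

text \<open>From level one on, each further commutator squares the trace, so a zero trace descends.
  The descent stops at level one, since y need not invert x.\<close>

lemma engel_trace_0:
  fixes x y :: "'k::field ^ 2 ^ 2"
  assumes two: "(2::'k) = 0" and x: "det x = 1" and y: "det y = 1" "trace y = 0"
    and "trace (engel_commutator SL x (Suc n) y) = 0"
  shows "trace (group_commutator SL x y) = 0"
  using assms(5)
proof (induction n)
  case (Suc n)
  let ?v = "engel_commutator SL x n y"
  let ?w = "engel_commutator SL x (Suc n) y"
  have v: "det ?v = 1" using SL.engel_commutator_closed[of x y n] x y by simp
  have w: "det ?w = 1" using SL.engel_commutator_closed[of x y "Suc n"] x y by simp
  have "engel_commutator SL x (Suc (Suc n)) y = inv\<^bsub>SL\<^esub> ?w ** inv\<^bsub>SL\<^esub> ?w"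
    using SL.commutator_commutator_involution[of ?v y] v y square_eq_one_if_trace_0[OF two y]
    by simp
  then have "trace (engel_commutator SL x (Suc (Suc n)) y) = (trace ?w)^2"
    by (simp only: trace_square_char_2[OF two] trace_SL_inv_2[OF w])
  then show ?case using Suc by simp
qed simp

text \<open>Here y^(-1) = y and x^(-1) = x + tr x, so [x,y] = (xy)^2 + tr(x) yxy. Its trace is
  tr(xy)^2 + tr(x)^2, a single square in characteristic two.\<close>

lemma trace_commutator_involution:
  fixes x y :: "'k::field ^ 2 ^ 2"
  assumes two: "(2::'k) = 0" and x: "det x = 1" and y: "det y = 1" "trace y = 0"
  shows "trace (group_commutator SL x y) = (trace (x ** (y + mat 1)))^2"
proof -
  note ch = char_2_simps[OF two]
  have yy: "y ** y = mat 1" by (rule square_eq_one_if_trace_0[OF two y])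
  then have iy: "inv\<^bsub>SL\<^esub> y = y" using SL.inv_equality[of y y] y by simp
  have ix: "inv\<^bsub>SL\<^esub> x = x + mat (trace x)"
    using x by (simp add: matrix_2_eq_iff SL_inv_2 trace_2 ch algebra_simps)
  have "group_commutator SL x y = (x ** y) ** (x ** y) + mat (trace x) ** (y ** x ** y)"
    by (simp add: group_commutator_def iy ix matrix_mul_assoc matrix_2_eq_iff matrix_mult_2 ch algebra_simps)
  moreover have "trace (mat (trace x) ** A) = trace x * trace A" for A :: "'k^2^2"
    by (simp add: trace_2 matrix_mult_2 algebra_simps)
  moreover have "trace (y ** x ** y) = trace x"
    using trace_mul_sym[of "y ** x" y] yy by (simp add: matrix_mul_assoc)
  ultimately have "trace (group_commutator SL x y) = (trace (x ** y))^2 + (trace x)^2"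
    by (simp add: trace_add trace_square_char_2[OF two] power2_eq_square)
  also have "\<dots> = (trace (x ** y) + trace x)^2"
    by (simp add: power2_eq_square algebra_simps ch)
  finally show ?thesis by (simp add: matrix_add_ldistrib trace_add)
qed

section \<open>An anisotropic torus\<close>

text \<open>The q - 1 nonzero elements cannot hit all q values. In characteristic two, such a t
  leaves X^2 + tX + 1 without a root in the field.\<close>

lemma exists_not_plus_inverse: "\<exists>t::'k::{field,finite}. \<forall>z. z \<noteq> 0 \<longrightarrow> z + inverse z \<noteq> t"
proof (rule ccontr)
  assume "\<not> ?thesis"
  then have "\<forall>t::'k. \<exists>z\<in>UNIV - {0}. t = z + inverse z" by (metis DiffI UNIV_I singletonD)
  then have "(UNIV :: 'k set) = (\<lambda>z. z + inverse z) ` (UNIV - {0})" by blast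
  then have "CARD('k) \<le> card (UNIV - {0::'k})" by (metis card_image_le finite)
  moreover have "card (UNIV - {0::'k}) < CARD('k)" by (rule psubset_card_mono) auto
  ultimately show False by (meson leD)
qed

text \<open>The companion matrix of \<open>X\<^sup>2 - t X - 1\<close>, whose determinant \<open>-1\<close> is \<open>1\<close> in characteristic two.\<close>

definition torus_gen :: "'k::field \<Rightarrow> 'k ^ 2 ^ 2" where
  "torus_gen t = vector [vector [0, 1], vector [1, t]]"

lemma torus_gen_nth [simp]:
  "torus_gen t$1$1 = 0" "torus_gen t$1$2 = 1" "torus_gen t$2$1 = 1" "torus_gen t$2$2 = t"
  by (simp_all add: torus_gen_def)

lemma torus_gen_nonscalar: "torus_gen t \<noteq> mat c"
  by (simp add: matrix_2_eq_iff)

text \<open>With x = a + b g for the generator g, the trace is b t. If it vanishes, x is a scalar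
  with a^2 = 1, hence the identity.\<close>

lemma torus_trace:
  fixes x :: "'k::field ^ 2 ^ 2"
  assumes two: "(2::'k) = 0" and "t \<noteq> 0" "torus_gen t ** x = x ** torus_gen t"
    and "det x = 1" "x \<noteq> mat 1"
  shows "trace x \<noteq> 0"
proof
  note ch = char_2_simps[OF two]
  assume tr: "trace x = 0"
  obtain a b where x: "x = mat a + mat b ** torus_gen t"
    using commutes_nonscalar_2 torus_gen_nonscalar assms by metis
  then have "b = 0" using tr \<open>t \<noteq> 0\<close> by (simp add: trace_2 matrix_mult_2 ch algebra_simps)
  moreover from this have "(a + 1)^2 = 0"
    using assms(4) x by (simp add: det_2 matrix_mult_2 power2_eq_square algebra_simps ch)
  ultimately show False
    using x assms(5) by (simp add: matrix_2_eq_iff matrix_mult_2 add_eq_0_iff ch)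
qed

lemma torus_commutator_involution:
  fixes x y :: "'k::field ^ 2 ^ 2"
  assumes two: "(2::'k) = 0" and t: "\<And>z. z \<noteq> 0 \<Longrightarrow> z + inverse z \<noteq> t"
    and x: "torus_gen t ** x = x ** torus_gen t" "trace x \<noteq> 0"
    and y: "det y = 1" "trace y = 0" "trace (x ** (y + mat 1)) = 0"
  shows "y = mat 1"
proof -
  note ch = char_2_simps[OF two]
  obtain a b where xab: "x = mat a + mat b ** torus_gen t"
    using commutes_nonscalar_2 torus_gen_nonscalar x by metis
  have "b \<noteq> 0" using x(2) by (auto simp: xab trace_2 matrix_mult_2 ch)
  \<comment> \<open>Now y + 1 has both diagonal entries m and square zero. The trace condition is
    linear in its entries (\<open>lin\<close>), and its vanishing determinant is
    \<open>quad\<close>.\<close>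
  define m where "m = y$1$1 + 1"
  have y22: "y$2$2 = y$1$1" using y(2) by (simp add: trace_2 add_eq_0_iff ch)
  have "trace (x ** (y + mat 1)) = b * (y$1$2 + y$2$1 + t * m)"
    by (simp add: xab trace_2 matrix_mult_2 m_def y22 algebra_simps ch)
  with y(3) \<open>b \<noteq> 0\<close> have lin: "y$1$2 + y$2$1 + t * m = 0" by simp
  have "m * m + y$1$2 * y$2$1 = det y + 1"
    by (simp add: det_2 m_def y22 algebra_simps ch)
  then have "m * m + y$1$2 * y$2$1 = 0" using y(1) by (simp add: ch)
  then have quad: "m * m = y$1$2 * y$2$1" by (simp add: add_eq_0_iff ch)
  have "m = 0"
  proof (rule ccontr)
    assume "m \<noteq> 0"
    then have "y$1$2 \<noteq> 0" using quad by auto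
    \<comment> \<open>By \<open>quad\<close>, z = \<open>y$1$2 / m\<close> has inverse
      \<open>y$2$1 / m\<close>; by \<open>lin\<close> the two add up to t, contrary to the choice of
      t.\<close>
    have "y$1$2 / m + inverse (y$1$2 / m) = (y$1$2 + y$2$1) / m"
      using quad \<open>m \<noteq> 0\<close> \<open>y$1$2 \<noteq> 0\<close> by (simp add: field_simps)
    also have "y$1$2 + y$2$1 = t * m" using lin by (simp add: add_eq_0_iff ch)
    finally show False using t[of "y$1$2 / m"] \<open>m \<noteq> 0\<close> \<open>y$1$2 \<noteq> 0\<close> by simp
  qed
  with lin quad show ?thesis
    by (auto simp: matrix_2_eq_iff y22 m_def add_eq_0_iff ch)
qed

lemma torus_engel_closed:
  fixes x y :: "'k::field ^ 2 ^ 2"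
  assumes two: "(2::'k) = 0" and t: "\<And>z. z \<noteq> 0 \<Longrightarrow> z + inverse z \<noteq> t"
    and x: "torus_gen t ** x = x ** torus_gen t" "det x = 1" "x \<noteq> mat 1"
    and y: "det y = 1" "y \<noteq> mat 1"
    and n: "n > 0" "engel_commutator SL x n y = mat 1"
  shows "torus_gen t ** y = y ** torus_gen t"
proof -
  note ch = char_2_simps[OF two]
  \<comment> \<open>For z = 1 the sum z + 1/z is 0.\<close>
  have "t \<noteq> 0" using t[of 1] by (simp add: ch)
  then have trx: "trace x \<noteq> 0" using torus_trace two x by blast
  have tr_y: "trace y \<noteq> 0"
  proof
    assume tr_y: "trace y = 0"
    obtain k where "n = Suc k" using n(1) gr0_implies_Suc by blast
    then have "trace (engel_commutator SL x (Suc k) y) = 0" using n(2) by (simp add: trace_2 ch)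
    then have "trace (group_commutator SL x y) = 0"
      by (rule engel_trace_0[OF two x(2) y(1) tr_y])
    then show False
      using torus_commutator_involution[OF two t x(1) trx y(1) tr_y] y(2)
      by (simp add: trace_commutator_involution[OF two x(2) y(1) tr_y])
  qed
  have "x ** y = y ** x"
    by (rule engel_imp_commutes[OF two x(2) trx y(1) tr_y, of n]) (simp add: n)
  \<comment> \<open>Both y and the generator centralise x, which is nonscalar because its trace is
    nonzero.\<close>
  then show ?thesis
    using commutes_trans_2[of x "torus_gen t" y] x(1) nonscalar_if_trace[OF two trx] by simp
qed

section \<open>Characteristic two and the final contradiction\<close>

lemma of_nat_CARD_eq_0: "of_nat CARD('k::{ring_1,finite}) = (0::'k)"
proof -
  \<comment> \<open>Translation by 1 permutes the ring, so adding \<open>CARD('k)\<close> times 1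
    leaves the sum of all elements unchanged.\<close>
  have "(\<Sum>x\<in>UNIV. x + 1) = (\<Sum>x\<in>UNIV. x :: 'k)"
    by (rule sum.reindex_bij_witness[of _ "\<lambda>x. x - 1" "\<lambda>x. x + 1"]) auto
  then show ?thesis by (simp add: sum.distrib)
qed

theorem theorem5p9:
  fixes f :: nat
  assumes "f \<ge> 1"
    and "CARD('k::{field, finite}) = 2 ^ f"
  shows "\<not> strongly_connected_digraph (with_proj (engel_graph (PSL :: ('k ^ 2 ^ 2) set monoid)))"
proof
  assume sc: "strongly_connected_digraph (with_proj (engel_graph (PSL :: ('k ^ 2 ^ 2) set monoid)))"
  have "(2::'k) ^ f = 0" using of_nat_CARD_eq_0[where 'k = 'k] assms(2) by simp
  then have two: "(2::'k) = 0" by simp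
  note ch = char_2_simps[OF two]
  obtain t :: 'k where t: "\<And>z. z \<noteq> 0 \<Longrightarrow> z + inverse z \<noteq> t"
    using exists_not_plus_inverse by blast
  have Z: "group_center (SL :: ('k ^ 2 ^ 2) monoid) = {\<one>\<^bsub>SL\<^esub>}"
    using group_center_SL_2[OF two] by simp
  have PSL: "(PSL :: ('k ^ 2 ^ 2) set monoid) = SL Mod {\<one>\<^bsub>SL\<^esub>}"
    by (simp only: PSL_def Z)
  let ?D = "engel_graph (SL Mod {\<one>\<^bsub>SL\<^esub>} :: ('k ^ 2 ^ 2) set monoid)"
  \<comment> \<open>The closed set consists of the singletons of the full matrix centraliser of the
    generator; its vertices are the nontrivial torus elements.\<close>
  let ?S = "{{x} | x :: 'k ^ 2 ^ 2. torus_gen t ** x = x ** torus_gen t}"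
  \<comment> \<open>A unipotent element outside the torus: its two products with the generator have
    upper left entries 0 and 1.\<close>
  let ?u = "vector [vector [1, 1], vector [0, 1]] :: 'k ^ 2 ^ 2"
  have "{torus_gen t} \<in> pverts ?D" "{?u} \<in> pverts ?D"
    unfolding SL.pverts_engel_graph_FactGroup_one[OF Z]
    by (auto simp: det_2 matrix_2_eq_iff ch)
  then have "{torus_gen t} \<rightarrow>\<^sup>*\<^bsub>with_proj ?D\<^esub> {?u}"
    using sc unfolding PSL strongly_connected_digraph_def by simp
  then have "{?u} \<in> ?S"
  proof (rule reachable_closed_set)
    fix X Y assume "(X, Y) \<in> parcs ?D" "X \<in> ?S"
    then show "Y \<in> ?S"
      unfolding SL.engel_graph_FactGroup_one_arc_iff[OF Z]
      using torus_engel_closed[OF two t] by auto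
  qed simp
  then have "torus_gen t ** ?u = ?u ** torus_gen t" by blast
  then have "(torus_gen t ** ?u)$1$1 = (?u ** torus_gen t)$1$1" by (rule arg_cong)
  then show False by (simp add: matrix_mult_2)
qed

end
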